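(* Let $G$ be a group, let $F$ be a free (left) $G$-set, and let $X$ be an index set bijective to the orbit set $F/G$. Then the map $$(G\wr X)\times F^X\to F^X,\qquad ((\tilde g,\sigma),\tilde f)\mapsto \tilde g\,(\tilde f\circ\sigma^{-1}),$$ where $(\tilde g(\tilde f\circ \sigma^{-1}))(x)=\tilde g(x)\cdot \tilde f(\sigma^{-1}(x))$ for $x\in X$, defines a left action of the wreath product $G\wr X$ on $F^X$. Moreover, the set $\mathrm{Fr}(F)\subset F^X$ of bases of $F$ is an invariant subset for this action, and $\mathrm{Fr}(F)$ with the restricted action is a $G\wr X$-torsor (i.e. the action of $G\wr X$ on $\mathrm{Fr}(F)$ is free and transitive).
   Context: $F^X$ is the set of functions $\tilde f\colon X\to F$. The set $G\times X$ carries the $G$-action $g(h,x)=(gh,x)$. For $\tilde f\in F^X$ the associated $G$-map is $\phi_{\tilde f}\colon G\times X\to F$, $(g,x)\mapsto g\cdot\tilde f(x)$. The tuple $\tilde f$ is called a basis of $F$ if $\phi_{\tilde f}$ is an isomorphism of $G$-sets; $\mathrm{Fr}(F)\subset F^X$ denotes the set of bases. The wreath product $G\wr X$ is the semi-direct product $G^X\rtimes \mathrm{Sym}(X)$, where $\mathrm{Sym}(X)$ is the group of all bijections of $X$, acting on $G^X$ (functions $X\to G$ with pointwise multiplication) by $\sigma\cdot\tilde g=\tilde g\circ\sigma^{-1}$; explicitly $(\tilde g,\sigma)(\tilde g',\sigma')=(\tilde g\,(\tilde g'\circ\sigma^{-1}),\sigma\sigma')$. *)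

theory Defs
  imports "HOL-Algebra.Group_Action" "HOL-Algebra.Product_Groups"
begin

text \<open>Left \<open>G\<close>-sets are pairs \<open>(E, \<phi>)\<close> with \<^term>\<open>group_action G E \<phi>\<close>. As everywhere in
  \<open>HOL-Algebra\<close>, functions on a carrier set are extensional; in particular the function
  set \<open>F\<^sup>X\<close> is \<^term>\<open>X \<rightarrow>\<^sub>E F\<close>.\<close>

locale free_action = group_action +
  assumes free: "\<lbrakk> g \<in> carrier G; x \<in> E; \<phi> g x = x \<rbrakk> \<Longrightarrow> g = \<one>"

text \<open>The library's \<^locale>\<open>transitive_action\<close> allows the empty set, a torsor must not be empty.\<close>

locale torsor = free_action + transitive_action +
  assumes nonempty: "E \<noteq> {}"

definition gset_hom ::
  "('g, 'm) monoid_scheme \<Rightarrow> 'a set \<Rightarrow> ('g \<Rightarrow> 'a \<Rightarrow> 'a) \<Rightarrow> 'b set \<Rightarrow> ('g \<Rightarrow> 'b \<Rightarrow> 'b) \<Rightarrow> ('a \<Rightarrow> 'b) set"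
  where "gset_hom G A \<alpha> B \<beta> =
    {h \<in> A \<rightarrow> B. \<forall>g \<in> carrier G. \<forall>a \<in> A. h (\<alpha> g a) = \<beta> g (h a)}"

definition gset_iso ::
  "('g, 'm) monoid_scheme \<Rightarrow> 'a set \<Rightarrow> ('g \<Rightarrow> 'a \<Rightarrow> 'a) \<Rightarrow> 'b set \<Rightarrow> ('g \<Rightarrow> 'b \<Rightarrow> 'b) \<Rightarrow> ('a \<Rightarrow> 'b) set"
  where "gset_iso G A \<alpha> B \<beta> = {h \<in> gset_hom G A \<alpha> B \<beta>. bij_betw h A B}"

definition times_action ::
  "('g, 'm) monoid_scheme \<Rightarrow> 'x set \<Rightarrow> 'g \<Rightarrow> 'g \<times> 'x \<Rightarrow> 'g \<times> 'x"
  where "times_action G X g = (\<lambda>(h, x) \<in> carrier G \<times> X. (g \<otimes>\<^bsub>G\<^esub> h, x))"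

definition assoc_map ::
  "('g, 'm) monoid_scheme \<Rightarrow> ('g \<Rightarrow> 'f \<Rightarrow> 'f) \<Rightarrow> 'x set \<Rightarrow> ('x \<Rightarrow> 'f) \<Rightarrow> 'g \<times> 'x \<Rightarrow> 'f"
  where "assoc_map G \<phi> X f = (\<lambda>(g, x) \<in> carrier G \<times> X. \<phi> g (f x))"

definition bases ::
  "('g, 'm) monoid_scheme \<Rightarrow> 'f set \<Rightarrow> ('g \<Rightarrow> 'f \<Rightarrow> 'f) \<Rightarrow> 'x set \<Rightarrow> ('x \<Rightarrow> 'f) set"
  where "bases G F \<phi> X =
    {f \<in> X \<rightarrow>\<^sub>E F.
      assoc_map G \<phi> X f \<in> gset_iso G (carrier G \<times> X) (times_action G X) F \<phi>}"

definition semidirect_product ::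
  "('n, 'a) monoid_scheme \<Rightarrow> ('h, 'b) monoid_scheme \<Rightarrow> ('h \<Rightarrow> 'n \<Rightarrow> 'n) \<Rightarrow> ('n \<times> 'h) monoid"
  where "semidirect_product N H \<theta> =
    \<lparr>carrier = carrier N \<times> carrier H,
     mult = (\<lambda>(n, h) (n', h'). (n \<otimes>\<^bsub>N\<^esub> \<theta> h n', h \<otimes>\<^bsub>H\<^esub> h')),
     one = (\<one>\<^bsub>N\<^esub>, \<one>\<^bsub>H\<^esub>)\<rparr>"

definition wreath_product ::
  "('g, 'm) monoid_scheme \<Rightarrow> 'x set \<Rightarrow> (('x \<Rightarrow> 'g) \<times> ('x \<Rightarrow> 'x)) monoid"
  where "wreath_product G X =
    semidirect_product (product_group X (\<lambda>_. G)) (BijGroup X)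
      (\<lambda>\<sigma>. \<lambda>g \<in> X \<rightarrow>\<^sub>E carrier G. compose X g (inv_into X \<sigma>))"

definition wreath_action ::
  "'f set \<Rightarrow> ('g \<Rightarrow> 'f \<Rightarrow> 'f) \<Rightarrow> 'x set \<Rightarrow> ('x \<Rightarrow> 'g) \<times> ('x \<Rightarrow> 'x) \<Rightarrow> ('x \<Rightarrow> 'f) \<Rightarrow> 'x \<Rightarrow> 'f"
  where "wreath_action F \<phi> X =
    (\<lambda>(g, \<sigma>). \<lambda>f \<in> X \<rightarrow>\<^sub>E F. \<lambda>x \<in> X. \<phi> (g x) (f (inv_into X \<sigma> x)))"

end

theory Submission
  imports Defs
begin

text \<open>
  In a free \<open>G\<close>-set \<open>F\<close>, a family \<open>f\<close> is a basis exactly when its members represent the orbits,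
  each orbit once: surjectivity of \<open>(g, x) \<mapsto> g f(x)\<close> says that every orbit is hit, and injectivity
  splits into injectivity of \<open>x \<mapsto> G f(x)\<close> and freeness of the action on \<open>F\<close>. This is lemma
  \<open>bases_eq_orbit_representatives\<close>, and it reduces everything about bases to the map
  \<open>x \<mapsto> G f(x)\<close> from \<open>X\<close> to the orbit set.

  On that map an element \<open>(g, \<sigma>)\<close> of the wreath product acts through \<open>\<sigma>\<close> alone, by
  precomposition with \<open>\<sigma>\<inverse>\<close>, which preserves bijectivity; so bases go to bases. Two bases
  induce two bijections from \<open>X\<close> to the orbit set, which differ by a unique permutation of \<open>X\<close>.
  Once the permutation is fixed, the two bases pick points in the same orbit at each index, and
  these differ by a group element, unique because the action is free. Hence exactly one element of
  the wreath product carries one basis to the other. A basis exists because a bijection from \<open>X\<close>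
  to the orbit set can be followed by a choice of representatives.
\<close>

section \<open>Groups acting on sets\<close>

text \<open>Each \<open>\<phi> g\<close> is a permutation because \<open>\<phi> (inv g)\<close> is its inverse, so the two
  familiar axioms are enough to get a homomorphism into the group of permutations.\<close>

lemma group_actionI:
  fixes G (structure)
  assumes "group G"
    and closed: "\<And>g x. \<lbrakk>g \<in> carrier G; x \<in> E\<rbrakk> \<Longrightarrow> \<phi> g x \<in> E"
    and ext: "\<And>g. g \<in> carrier G \<Longrightarrow> \<phi> g \<in> extensional E"
    and one: "\<And>x. x \<in> E \<Longrightarrow> \<phi> \<one> x = x"
    and mult: "\<And>g h x. \<lbrakk>g \<in> carrier G; h \<in> carrier G; x \<in> E\<rbrakk> \<Longrightarrow> \<phi> (g \<otimes> h) x = \<phi> g (\<phi> h x)"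
  shows "group_action G E \<phi>"
proof -
  interpret group G by fact
  have Bij: "\<phi> g \<in> Bij E" if g: "g \<in> carrier G" for g
  proof -
    have "\<phi> (inv g) (\<phi> g x) = x" "\<phi> g (\<phi> (inv g) x) = x" if "x \<in> E" for x
      using that g mult[of "inv g" g x] mult[of g "inv g" x] one by simp_all
    then have "bij_betw (\<phi> g) E E"
      using g closed by (intro bij_betw_byWitness[where f' = "\<phi> (inv g)"]) auto
    then show ?thesis
      using ext[OF g] by (simp add: Bij_def)
  qed
  have "\<phi> \<in> hom G (BijGroup E)"
  proof (rule homI)
    fix g h assume g: "g \<in> carrier G" and h: "h \<in> carrier G"
    have "\<phi> (g \<otimes> h) = compose E (\<phi> g) (\<phi> h)"
      by (rule extensionalityI[OF ext compose_extensional]) (simp_all add: g h mult compose_eq)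
    then show "\<phi> (g \<otimes> h) = \<phi> g \<otimes>\<^bsub>BijGroup E\<^esub> \<phi> h"
      by (simp add: BijGroup_def Bij g h)
  qed (simp add: BijGroup_def Bij)
  then show ?thesis
    by (simp add: group_action_def group_hom_def group_hom_axioms_def group_BijGroup is_group)
qed

context group_action
begin

lemma group_G: "group G"
  using group_hom by (rule group_hom.axioms)

lemma one_act: "x \<in> E \<Longrightarrow> \<phi> \<one> x = x"
  by (metis id_eq_one restrict_apply')

lemma act_closed: "\<lbrakk>g \<in> carrier G; x \<in> E\<rbrakk> \<Longrightarrow> \<phi> g x \<in> E"
  using element_image by blast

lemma restrict_invariant:
  assumes "B \<subseteq> E" and "\<And>g x. \<lbrakk>g \<in> carrier G; x \<in> B\<rbrakk> \<Longrightarrow> \<phi> g x \<in> B"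
  shows "group_action G B (\<lambda>g. restrict (\<phi> g) B)"
  using assms
  by (intro group_actionI group_G) (auto simp: one_act composition_rule subset_iff)

lemma orbit_subset: "x \<in> E \<Longrightarrow> orbit G \<phi> x \<subseteq> E"
  by (auto simp: orbit_def act_closed)

lemma orbit_eq_iff:
  assumes "x \<in> E" "y \<in> E"
  shows "orbit G \<phi> x = orbit G \<phi> y \<longleftrightarrow> y \<in> orbit G \<phi> x"
proof
  assume "y \<in> orbit G \<phi> x"
  then have "x \<in> orbit G \<phi> y"
    using assms orbit_sym by blast
  with \<open>y \<in> orbit G \<phi> x\<close> assms show "orbit G \<phi> x = orbit G \<phi> y"
    using orbit_trans orbit_subset by blast
qed (use assms orbit_refl in blast)

lemma orbit_act: "\<lbrakk>g \<in> carrier G; x \<in> E\<rbrakk> \<Longrightarrow> orbit G \<phi> (\<phi> g x) = orbit G \<phi> x"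
  using orbit_eq_iff[of x "\<phi> g x"] by (auto simp: orbit_def act_closed)

end

lemma (in free_action) act_cancel:
  assumes g: "g \<in> carrier G" and h: "h \<in> carrier G" and x: "x \<in> E" and eq: "\<phi> g x = \<phi> h x"
  shows "g = h"
proof -
  interpret group G by (rule group_G)
  have "\<phi> (inv h \<otimes> g) x = \<phi> (inv h) (\<phi> h x)"
    using g h x eq by (simp add: composition_rule)
  also have "\<dots> = x"
    using orbit_sym_aux[OF h x] by simp
  finally have "inv h \<otimes> g = \<one>"
    using g h x free by simp
  then show ?thesis
    using g h by (metis inv_equality inv_inv inv_closed)
qed

section \<open>The wreath product\<close>

lemma group_semidirect_product:
  assumes "group N" "group H"
    and hom: "\<And>h. h \<in> carrier H \<Longrightarrow> \<theta> h \<in> hom N N"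
    and one: "\<And>n. n \<in> carrier N \<Longrightarrow> \<theta> \<one>\<^bsub>H\<^esub> n = n"
    and mult: "\<And>h h' n. \<lbrakk>h \<in> carrier H; h' \<in> carrier H; n \<in> carrier N\<rbrakk>
                 \<Longrightarrow> \<theta> (h \<otimes>\<^bsub>H\<^esub> h') n = \<theta> h (\<theta> h' n)"
  shows "group (semidirect_product N H \<theta>)"
proof -
  interpret N: group N by fact
  interpret H: group H by fact
  have closed: "\<theta> h n \<in> carrier N" if "h \<in> carrier H" "n \<in> carrier N" for h n
    using hom[OF that(1)] that(2) by (rule hom_in_carrier)
  have distrib: "\<theta> h (n \<otimes>\<^bsub>N\<^esub> n') = \<theta> h n \<otimes>\<^bsub>N\<^esub> \<theta> h n'"
    if "h \<in> carrier H" "n \<in> carrier N" "n' \<in> carrier N" for h n n'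
    using hom[OF that(1)] that(2,3) by (rule hom_mult)
  show ?thesis
  proof (rule groupI)
    fix w assume "w \<in> carrier (semidirect_product N H \<theta>)"
    then obtain n h where w: "w = (n, h)" "n \<in> carrier N" "h \<in> carrier H"
      by (auto simp: semidirect_product_def)
    let ?k = "inv\<^bsub>H\<^esub> h"
    \<comment> \<open>The equation \<open>m \<theta>(k)(n) = 1\<close> forces \<open>m = \<theta>(k)(n\<inverse>)\<close>.\<close>
    let ?m = "\<theta> ?k (inv\<^bsub>N\<^esub> n)"
    have "?m \<otimes>\<^bsub>N\<^esub> \<theta> ?k n = \<theta> ?k \<one>\<^bsub>N\<^esub>"
      using w distrib[of ?k "inv\<^bsub>N\<^esub> n" n] by simp
    also have "\<dots> = \<one>\<^bsub>N\<^esub>"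
      using w hom by (simp add: hom_one[OF _ \<open>group N\<close> \<open>group N\<close>])
    finally show "\<exists>v \<in> carrier (semidirect_product N H \<theta>).
        v \<otimes>\<^bsub>semidirect_product N H \<theta>\<^esub> w = \<one>\<^bsub>semidirect_product N H \<theta>\<^esub>"
      using w by (intro bexI[of _ "(?m, ?k)"]) (simp_all add: semidirect_product_def closed)
  qed (auto simp: semidirect_product_def closed one mult distrib N.m_assoc H.m_assoc)
qed

lemma Bij_bij_betw: "\<sigma> \<in> Bij X \<Longrightarrow> bij_betw \<sigma> X X"
  by (simp add: Bij_def)

lemma inv_into_compose_Bij:
  assumes "\<sigma> \<in> Bij X" "\<tau> \<in> Bij X" "x \<in> X"
  shows "inv_into X (compose X \<sigma> \<tau>) x = inv_into X \<tau> (inv_into X \<sigma> x)"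
proof (rule inv_into_f_eq)
  show "inv_into X \<tau> (inv_into X \<sigma> x) \<in> X"
    using assms by (simp add: Bij_inv_into_mem)
  show "inj_on (compose X \<sigma> \<tau>) X"
    using Bij_bij_betw[OF compose_Bij[OF assms(1,2)]] by (simp add: bij_betw_def)
  show "compose X \<sigma> \<tau> (inv_into X \<tau> (inv_into X \<sigma> x)) = x"
    using assms by (simp add: compose_eq bij_betw_inv_into_right[OF Bij_bij_betw] Bij_inv_into_mem)
qed

lemma inv_into_identity: "x \<in> X \<Longrightarrow> inv_into X (\<lambda>x \<in> X. x) x = x"
  by (rule inv_into_f_eq) (auto simp: inj_on_def)

lemma carrier_wreath_product:
  "carrier (wreath_product G X) = (X \<rightarrow>\<^sub>E carrier G) \<times> Bij X"
  by (simp add: wreath_product_def semidirect_product_def BijGroup_def)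

lemma one_wreath_product: "\<one>\<^bsub>wreath_product G X\<^esub> = (\<lambda>x \<in> X. \<one>\<^bsub>G\<^esub>, \<lambda>x \<in> X. x)"
  by (simp add: wreath_product_def semidirect_product_def BijGroup_def)

lemma mult_wreath_product:
  assumes "g' \<in> X \<rightarrow>\<^sub>E carrier G" "\<sigma> \<in> Bij X" "\<tau> \<in> Bij X"
  shows "(g, \<sigma>) \<otimes>\<^bsub>wreath_product G X\<^esub> (g', \<tau>)
    = (\<lambda>x \<in> X. g x \<otimes>\<^bsub>G\<^esub> g' (inv_into X \<sigma> x), compose X \<sigma> \<tau>)"
  using assms
  by (auto simp: wreath_product_def semidirect_product_def BijGroup_def compose_def
      intro!: restrict_ext)

lemma group_wreath_product:
  assumes "group G"
  shows "group (wreath_product G X)"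
  unfolding wreath_product_def
proof (rule group_semidirect_product)
  interpret group G by fact
  let ?N = "product_group X (\<lambda>_. G)"
  let ?\<theta> = "\<lambda>\<sigma>. \<lambda>g \<in> X \<rightarrow>\<^sub>E carrier G. compose X g (inv_into X \<sigma>)"
  show "group ?N"
    using assms by simp
  show "group (BijGroup X)"
    by (rule group_BijGroup)
  have closed: "compose X g (inv_into X \<sigma>) \<in> X \<rightarrow>\<^sub>E carrier G"
    if "\<sigma> \<in> Bij X" "g \<in> X \<rightarrow>\<^sub>E carrier G" for \<sigma> g
    using that Bij_inv_into_mem[OF that(1)] by (auto simp: compose_def)
  show "?\<theta> \<sigma> \<in> hom ?N ?N" if "\<sigma> \<in> carrier (BijGroup X)" for \<sigma>
  proof (rule homI)
    have \<sigma>: "\<sigma> \<in> Bij X"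
      using that by (simp add: BijGroup_def)
    fix g g' assume g: "g \<in> carrier ?N" "g' \<in> carrier ?N"
    show "?\<theta> \<sigma> g \<in> carrier ?N"
      using g closed[OF \<sigma>] by simp
    have "g \<otimes>\<^bsub>?N\<^esub> g' \<in> X \<rightarrow>\<^sub>E carrier G"
      using g by auto
    then show "?\<theta> \<sigma> (g \<otimes>\<^bsub>?N\<^esub> g') = ?\<theta> \<sigma> g \<otimes>\<^bsub>?N\<^esub> ?\<theta> \<sigma> g'"
      using g Bij_inv_into_mem[OF \<sigma>] by (auto simp: compose_def intro!: restrict_ext)
  qed
  show "?\<theta> \<one>\<^bsub>BijGroup X\<^esub> g = g" if "g \<in> carrier ?N" for g
  proof -
    have "compose X g (inv_into X (\<lambda>x \<in> X. x)) = g"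
      using that
      by (intro extensionalityI[OF compose_extensional]) (auto simp: compose_eq inv_into_identity PiE_iff)
    then show ?thesis
      using that by (simp add: BijGroup_def)
  qed
  show "?\<theta> (\<sigma> \<otimes>\<^bsub>BijGroup X\<^esub> \<tau>) g = ?\<theta> \<sigma> (?\<theta> \<tau> g)"
    if "\<sigma> \<in> carrier (BijGroup X)" "\<tau> \<in> carrier (BijGroup X)" "g \<in> carrier ?N" for \<sigma> \<tau> g
  proof -
    have \<sigma>\<tau>: "\<sigma> \<in> Bij X" "\<tau> \<in> Bij X" and g: "g \<in> X \<rightarrow>\<^sub>E carrier G"
      using that by (simp_all add: BijGroup_def)
    have "compose X g (inv_into X (compose X \<sigma> \<tau>))
        = compose X (compose X g (inv_into X \<tau>)) (inv_into X \<sigma>)"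
      using \<sigma>\<tau>
      by (intro extensionalityI[OF compose_extensional compose_extensional])
        (simp add: compose_eq inv_into_compose_Bij Bij_inv_into_mem)
    then show ?thesis
      using \<sigma>\<tau> g closed[OF \<sigma>\<tau>(2) g] by (simp add: BijGroup_def)
  qed
qed

lemma wreath_action_apply:
  assumes "f \<in> X \<rightarrow>\<^sub>E F" "x \<in> X"
  shows "wreath_action F \<phi> X (g, \<sigma>) f x = \<phi> (g x) (f (inv_into X \<sigma> x))"
  using assms by (simp add: wreath_action_def)

context group_action
begin

lemma wreath_action_closed:
  assumes "g \<in> X \<rightarrow>\<^sub>E carrier G" "\<sigma> \<in> Bij X" "f \<in> X \<rightarrow>\<^sub>E E"
  shows "wreath_action E \<phi> X (g, \<sigma>) f \<in> X \<rightarrow>\<^sub>E E"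
  using assms Bij_inv_into_mem[OF assms(2)]
  by (auto simp: wreath_action_def PiE_iff intro!: act_closed)

lemma group_action_wreath_action:
  "group_action (wreath_product G X) (X \<rightarrow>\<^sub>E E) (wreath_action E \<phi> X)"
proof (rule group_actionI)
  show "group (wreath_product G X)"
    by (rule group_wreath_product[OF group_G])
next
  fix w f assume "w \<in> carrier (wreath_product G X)" "f \<in> X \<rightarrow>\<^sub>E E"
  then show "wreath_action E \<phi> X w f \<in> X \<rightarrow>\<^sub>E E"
    by (cases w) (simp add: carrier_wreath_product wreath_action_closed)
next
  fix w
  show "wreath_action E \<phi> X w \<in> extensional (X \<rightarrow>\<^sub>E E)"
    by (cases w) (simp add: wreath_action_def)
next
  fix f assume f: "f \<in> X \<rightarrow>\<^sub>E E"
  have "wreath_action E \<phi> X \<one>\<^bsub>wreath_product G X\<^esub> f = (\<lambda>x \<in> X. f x)"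
    unfolding one_wreath_product using f
    by (auto simp: wreath_action_def inv_into_identity PiE_iff one_act intro!: restrict_ext)
  also have "\<dots> = f"
    using f by (simp add: PiE_iff extensional_restrict)
  finally show "wreath_action E \<phi> X \<one>\<^bsub>wreath_product G X\<^esub> f = f" .
next
  fix v w f
  assume "v \<in> carrier (wreath_product G X)" "w \<in> carrier (wreath_product G X)"
    and f: "f \<in> X \<rightarrow>\<^sub>E E"
  then obtain g \<sigma> g' \<tau>
    where v: "v = (g, \<sigma>)" "g \<in> X \<rightarrow>\<^sub>E carrier G" and \<sigma>: "\<sigma> \<in> Bij X"
      and w: "w = (g', \<tau>)" "g' \<in> X \<rightarrow>\<^sub>E carrier G" and \<tau>: "\<tau> \<in> Bij X"
    by (auto simp: carrier_wreath_product)
  have wf: "wreath_action E \<phi> X w f \<in> X \<rightarrow>\<^sub>E E"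
    using w f \<tau> wreath_action_closed by simp
  have "wreath_action E \<phi> X (v \<otimes>\<^bsub>wreath_product G X\<^esub> w) f
      = (\<lambda>x \<in> X. \<phi> (g x \<otimes> g' (inv_into X \<sigma> x)) (f (inv_into X \<tau> (inv_into X \<sigma> x))))"
    using f v w \<sigma> \<tau>
    by (auto simp: mult_wreath_product wreath_action_def inv_into_compose_Bij intro!: restrict_ext)
  also have "\<dots> = (\<lambda>x \<in> X. \<phi> (g x) (\<phi> (g' (inv_into X \<sigma> x)) (f (inv_into X \<tau> (inv_into X \<sigma> x)))))"
    using f v w Bij_inv_into_mem[OF \<sigma>] Bij_inv_into_mem[OF \<tau>]
    by (intro restrict_ext composition_rule) (auto simp: PiE_iff)
  also have "\<dots> = wreath_action E \<phi> X v (wreath_action E \<phi> X w f)"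
    using wf f Bij_inv_into_mem[OF \<sigma>] unfolding v w
    by (auto simp: wreath_action_def intro!: restrict_ext)
  finally show "wreath_action E \<phi> X (v \<otimes>\<^bsub>wreath_product G X\<^esub> w) f
      = wreath_action E \<phi> X v (wreath_action E \<phi> X w f)" .
qed

text \<open>The component \<open>g\<close> moves points only inside their orbits, so on orbits only the
  permutation is visible.\<close>

lemma orbit_wreath_action:
  assumes "g \<in> X \<rightarrow>\<^sub>E carrier G" "\<sigma> \<in> Bij X" "f \<in> X \<rightarrow>\<^sub>E E" "x \<in> X"
  shows "orbit G \<phi> (wreath_action E \<phi> X (g, \<sigma>) f x) = orbit G \<phi> (f (inv_into X \<sigma> x))"
proof -
  have "g x \<in> carrier G" "f (inv_into X \<sigma> x) \<in> E"
    using assms by (auto simp: Bij_inv_into_mem)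
  then show ?thesis
    using assms by (simp add: wreath_action_apply orbit_act)
qed

end

section \<open>Bases of a free action\<close>

context free_action
begin

text \<open>The image of \<open>{g} \<times> X\<close>, for varying \<open>g\<close>, sweeps out the orbits of the points \<open>f x\<close>, so
  surjectivity on either side means that these orbits cover \<open>E\<close>. Freeness enters only in
  injectivity: two pairs with the same image have the same orbit, hence the same index, and then
  the group elements agree because they move one point to the same place.\<close>

lemma bij_betw_assoc_map_iff:
  assumes f: "f \<in> X \<rightarrow>\<^sub>E E"
  shows "bij_betw (assoc_map G \<phi> X f) (carrier G \<times> X) E
    \<longleftrightarrow> bij_betw (\<lambda>x. orbit G \<phi> (f x)) X (orbits G E \<phi>)" (is "?L \<longleftrightarrow> ?R")
proof -
  interpret group G by (rule group_G)
  have fE: "f x \<in> E" if "x \<in> X" for x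
    using f that by auto
  have inj: "inj_on (assoc_map G \<phi> X f) (carrier G \<times> X) \<longleftrightarrow> inj_on (\<lambda>x. orbit G \<phi> (f x)) X"
  proof
    assume L: "inj_on (assoc_map G \<phi> X f) (carrier G \<times> X)"
    show "inj_on (\<lambda>x. orbit G \<phi> (f x)) X"
    proof (rule inj_onI)
      fix x y assume xy: "x \<in> X" "y \<in> X" and "orbit G \<phi> (f x) = orbit G \<phi> (f y)"
      then obtain g where g: "g \<in> carrier G" "f y = \<phi> g (f x)"
        using orbit_eq_iff[OF fE fE] by (auto simp: orbit_def)
      then have "assoc_map G \<phi> X f (\<one>, y) = assoc_map G \<phi> X f (g, x)"
        using xy by (simp add: assoc_map_def one_act fE flip: g(2))
      then show "x = y"
        using inj_onD[OF L] g(1) xy by fastforce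
    qed
  next
    assume R: "inj_on (\<lambda>x. orbit G \<phi> (f x)) X"
    show "inj_on (assoc_map G \<phi> X f) (carrier G \<times> X)"
    proof (rule inj_onI, clarify)
      fix g x h y
      assume gh: "g \<in> carrier G" "h \<in> carrier G" and xy: "x \<in> X" "y \<in> X"
        and "assoc_map G \<phi> X f (g, x) = assoc_map G \<phi> X f (h, y)"
      then have eq: "\<phi> g (f x) = \<phi> h (f y)"
        by (simp add: assoc_map_def)
      then have "orbit G \<phi> (f x) = orbit G \<phi> (f y)"
        using gh xy fE by (metis orbit_act)
      then have "x = y"
        using inj_onD[OF R] xy by blast
      with eq show "g = h \<and> x = y"
        using act_cancel gh xy fE by blast
    qed
  qed
  have image: "assoc_map G \<phi> X f ` (carrier G \<times> X) = (\<Union>x \<in> X. orbit G \<phi> (f x))"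
    by (auto simp: assoc_map_def orbit_def image_iff Bex_def)
  have surj: "assoc_map G \<phi> X f ` (carrier G \<times> X) = E
      \<longleftrightarrow> (\<lambda>x. orbit G \<phi> (f x)) ` X = orbits G E \<phi>"
  proof
    assume L: "assoc_map G \<phi> X f ` (carrier G \<times> X) = E"
    have "orbit G \<phi> y \<in> (\<lambda>x. orbit G \<phi> (f x)) ` X" if y: "y \<in> E" for y
    proof -
      obtain x where "x \<in> X" "y \<in> orbit G \<phi> (f x)"
        using y L image by blast
      then show ?thesis
        using orbit_eq_iff[OF fE y] by blast
    qed
    then show "(\<lambda>x. orbit G \<phi> (f x)) ` X = orbits G E \<phi>"
      using fE by (auto simp: orbits_def)
  next
    assume "(\<lambda>x. orbit G \<phi> (f x)) ` X = orbits G E \<phi>"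
    then show "assoc_map G \<phi> X f ` (carrier G \<times> X) = E"
      using image orbits_coverture by simp
  qed
  show ?thesis
    by (simp add: bij_betw_def inj surj)
qed

lemma bases_eq_orbit_representatives:
  "bases G E \<phi> X
    = {f \<in> X \<rightarrow>\<^sub>E E. bij_betw (\<lambda>x. orbit G \<phi> (f x)) X (orbits G E \<phi>)}"
proof -
  interpret group G by (rule group_G)
  have "assoc_map G \<phi> X f \<in> gset_hom G (carrier G \<times> X) (times_action G X) E \<phi>"
    if "f \<in> X \<rightarrow>\<^sub>E E" for f
  proof -
    have fE: "f x \<in> E" if "x \<in> X" for x
      using \<open>f \<in> X \<rightarrow>\<^sub>E E\<close> that by auto
    show ?thesis
      by (auto simp: gset_hom_def assoc_map_def times_action_def act_closed composition_rule fE)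
  qed
  then show ?thesis
    by (auto simp: bases_def gset_iso_def bij_betw_assoc_map_iff)
qed

lemma wreath_action_bases:
  assumes w: "w \<in> carrier (wreath_product G X)" and f: "f \<in> bases G E \<phi> X"
  shows "wreath_action E \<phi> X w f \<in> bases G E \<phi> X"
proof -
  obtain g \<sigma> where w': "w = (g, \<sigma>)" and g: "g \<in> X \<rightarrow>\<^sub>E carrier G" and \<sigma>: "\<sigma> \<in> Bij X"
    using w by (auto simp: carrier_wreath_product)
  have fE: "f \<in> X \<rightarrow>\<^sub>E E" and bij: "bij_betw (\<lambda>x. orbit G \<phi> (f x)) X (orbits G E \<phi>)"
    using f by (simp_all add: bases_eq_orbit_representatives)
  have "bij_betw ((\<lambda>x. orbit G \<phi> (f x)) \<circ> inv_into X \<sigma>) X (orbits G E \<phi>)"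
    using bij_betw_inv_into[OF Bij_bij_betw[OF \<sigma>]] bij by (rule bij_betw_trans)
  then have "bij_betw (\<lambda>x. orbit G \<phi> (wreath_action E \<phi> X w f x)) X (orbits G E \<phi>)"
    by (rule bij_betw_cong[THEN iffD1, rotated]) (simp add: w' orbit_wreath_action[OF g \<sigma> fE])
  then show ?thesis
    using wreath_action_closed[OF g \<sigma> fE] by (simp add: bases_eq_orbit_representatives w')
qed

text \<open>Passing to orbits determines \<open>\<sigma>\<close>, since distinct members of a basis lie in distinct orbits.
  With \<open>\<sigma>\<close> trivial, each \<open>g x\<close> fixes the point \<open>f x\<close>, and freeness on \<open>E\<close> makes it trivial.\<close>

lemma wreath_action_bases_free:
  assumes w: "w \<in> carrier (wreath_product G X)" and f: "f \<in> bases G E \<phi> X"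
    and fixed: "wreath_action E \<phi> X w f = f"
  shows "w = \<one>\<^bsub>wreath_product G X\<^esub>"
proof -
  obtain g \<sigma> where w': "w = (g, \<sigma>)" and g: "g \<in> X \<rightarrow>\<^sub>E carrier G" and \<sigma>: "\<sigma> \<in> Bij X"
    using w by (auto simp: carrier_wreath_product)
  have fE: "f \<in> X \<rightarrow>\<^sub>E E" and bij: "bij_betw (\<lambda>x. orbit G \<phi> (f x)) X (orbits G E \<phi>)"
    using f by (simp_all add: bases_eq_orbit_representatives)
  have inv: "inv_into X \<sigma> x = x" if x: "x \<in> X" for x
  proof -
    have "orbit G \<phi> (f (inv_into X \<sigma> x)) = orbit G \<phi> (f x)"
      using orbit_wreath_action[OF g \<sigma> fE x] fixed w' by simp
    then show ?thesis
      using bij_betw_imp_inj_on[OF bij] Bij_inv_into_mem[OF \<sigma> x] x by (auto dest: inj_onD)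
  qed
  have "\<sigma> x = x" if "x \<in> X" for x
    using that inv bij_betw_inv_into_right[OF Bij_bij_betw[OF \<sigma>] that] by simp
  then have "\<sigma> = (\<lambda>x \<in> X. x)"
    using \<sigma> by (intro extensionalityI[where A = X]) (auto simp: Bij_def)
  moreover have "g x = \<one>" if x: "x \<in> X" for x
  proof (rule free)
    show "g x \<in> carrier G" "f x \<in> E"
      using g fE x by auto
    show "\<phi> (g x) (f x) = f x"
      using wreath_action_apply[OF fE x, of \<phi> g \<sigma>] fixed w' inv[OF x] by simp
  qed
  then have "g = (\<lambda>x \<in> X. \<one>)"
    using g by (intro extensionalityI[where A = X]) (auto simp: PiE_iff)
  ultimately show ?thesis
    by (simp add: w' one_wreath_product)
qed

text \<open>The orbit bijections of the two bases determine \<open>\<sigma>\<close>; after permuting by it, the bases lie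
  in the same orbit at each index, and \<open>g x\<close> is chosen to move one point to the other.\<close>

lemma wreath_action_bases_transitive:
  assumes f: "f \<in> bases G E \<phi> X" and f': "f' \<in> bases G E \<phi> X"
  shows "\<exists>w \<in> carrier (wreath_product G X). wreath_action E \<phi> X w f = f'"
proof -
  let ?o = "\<lambda>x. orbit G \<phi> (f x)" and ?o' = "\<lambda>x. orbit G \<phi> (f' x)"
  have fE: "f \<in> X \<rightarrow>\<^sub>E E" and bij: "bij_betw ?o X (orbits G E \<phi>)"
    and f'E: "f' \<in> X \<rightarrow>\<^sub>E E" and bij': "bij_betw ?o' X (orbits G E \<phi>)"
    using f f' by (simp_all add: bases_eq_orbit_representatives)
  \<comment> \<open>The permutation has to satisfy \<open>G f'(x) = G f(\<sigma>\<inverse> x)\<close>, that is, \<open>G f'(\<sigma> x) = G f(x)\<close>.\<close>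
  define \<sigma> where "\<sigma> = restrict (inv_into X ?o' \<circ> ?o) X"
  have "bij_betw (inv_into X ?o' \<circ> ?o) X X"
    using bij bij_betw_inv_into[OF bij'] by (rule bij_betw_trans)
  then have \<sigma>: "\<sigma> \<in> Bij X"
    by (simp add: \<sigma>_def Bij_def)
  have orb: "\<exists>g \<in> carrier G. \<phi> g (f (inv_into X \<sigma> x)) = f' x" if x: "x \<in> X" for x
  proof -
    let ?y = "inv_into X \<sigma> x"
    have y: "?y \<in> X" and "\<sigma> ?y = x"
      using Bij_inv_into_mem[OF \<sigma> x] bij_betw_inv_into_right[OF Bij_bij_betw[OF \<sigma>] x] by auto
    then have "?o' x = ?o' (inv_into X ?o' (?o ?y))"
      by (simp add: \<sigma>_def)
    also have "\<dots> = ?o ?y"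
      using bij_betwE[OF bij] y by (intro bij_betw_inv_into_right[OF bij']) blast
    finally have "f' x \<in> ?o ?y"
      using orbit_eq_iff[of "f ?y" "f' x"] fE f'E x y by auto
    then show ?thesis
      by (auto simp: orbit_def)
  qed
  then obtain g where g: "\<And>x. x \<in> X \<Longrightarrow> g x \<in> carrier G"
      "\<And>x. x \<in> X \<Longrightarrow> \<phi> (g x) (f (inv_into X \<sigma> x)) = f' x"
    by metis
  let ?w = "(restrict g X, \<sigma>)"
  have "restrict g X \<in> X \<rightarrow>\<^sub>E carrier G"
    using g by auto
  moreover from this have "wreath_action E \<phi> X ?w f = f'"
    using wreath_action_closed[OF _ \<sigma> fE] f'E
    by (intro PiE_ext) (auto simp: wreath_action_apply[OF fE] g)
  ultimately show ?thesis
    using \<sigma> by (intro bexI[of _ ?w]) (simp_all add: carrier_wreath_product)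
qed

lemma bases_nonempty:
  assumes b: "bij_betw b X (orbits G E \<phi>)"
  shows "bases G E \<phi> X \<noteq> {}"
proof -
  have "\<exists>y \<in> E. orbit G \<phi> y = b x" if "x \<in> X" for x
    using bij_betwE[OF b] that by (fastforce simp: orbits_def)
  then obtain f where f: "\<And>x. x \<in> X \<Longrightarrow> f x \<in> E" "\<And>x. x \<in> X \<Longrightarrow> orbit G \<phi> (f x) = b x"
    by metis
  have "bij_betw (\<lambda>x. orbit G \<phi> (restrict f X x)) X (orbits G E \<phi>)"
    using b by (rule bij_betw_cong[THEN iffD1, rotated]) (simp add: f)
  then have "restrict f X \<in> bases G E \<phi> X"
    using f by (simp add: bases_eq_orbit_representatives)
  then show ?thesis
    by blast
qed

lemma torsor_bases:
  assumes "bij_betw b X (orbits G E \<phi>)"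
  shows "torsor (wreath_product G X) (bases G E \<phi> X)
    (\<lambda>w. restrict (wreath_action E \<phi> X w) (bases G E \<phi> X))"
proof -
  interpret W: group_action "wreath_product G X" "X \<rightarrow>\<^sub>E E" "wreath_action E \<phi> X"
    by (rule group_action_wreath_action)
  interpret B: group_action "wreath_product G X" "bases G E \<phi> X"
    "\<lambda>w. restrict (wreath_action E \<phi> X w) (bases G E \<phi> X)"
  proof (rule W.restrict_invariant)
    show "bases G E \<phi> X \<subseteq> X \<rightarrow>\<^sub>E E"
      by (auto simp: bases_def)
  qed (rule wreath_action_bases)
  show ?thesis
    using wreath_action_bases_free wreath_action_bases_transitive bases_nonempty[OF assms]
    by unfold_locales simp_all
qed

end

theorem proposition3p9:
  fixes G :: "('g, 'm) monoid_scheme"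
    and F :: "'f set" and \<phi> :: "'g \<Rightarrow> 'f \<Rightarrow> 'f"
    and X :: "'x set"
  assumes "group G"
    and "free_action G F \<phi>"
    and "\<exists>b. bij_betw b X (orbits G F \<phi>)"
  shows "group_action (wreath_product G X) (X \<rightarrow>\<^sub>E F) (wreath_action F \<phi> X)
    \<and> (\<forall>w \<in> carrier (wreath_product G X). \<forall>f \<in> bases G F \<phi> X.
          wreath_action F \<phi> X w f \<in> bases G F \<phi> X)
    \<and> torsor (wreath_product G X) (bases G F \<phi> X)
          (\<lambda>w. restrict (wreath_action F \<phi> X w) (bases G F \<phi> X))"
proof -
  interpret free_action G F \<phi> by fact
  show ?thesis
    using assms(3) group_action_wreath_action wreath_action_bases torsor_bases by blast
qed

end
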